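(* Let $P \subseteq \mathbb{R}^d$ be a rational polytope. Then $P$ is semi-reflexive if and only if $P$ can be written as $$P = \bigcap_{i=1}^n \{x \in \mathbb{R}^d \mid \langle a_i, x\rangle \le b_i\}$$ for some $n$, where every $a_i$ is an integer vector in $\mathbb{Z}^d$ and every $b_i \in \{0,1\}$.
   Context: For a polytope $P \subseteq \mathbb{R}^d$ and real $s > 0$, let $L_P(s) = \#(sP \cap \mathbb{Z}^d)$, where $sP = \{sx \mid x \in P\}$ and $\#$ denotes cardinality; by convention $L_P(0) = 1$. A polytope $P$ is called semi-reflexive if $P$ is rational (all its vertices have rational coordinates) and $L_P(s) = L_P(\lfloor s \rfloor)$ for all real $s \ge 0$. *)

theory Defs
  imports "HOL-Analysis.Analysis"
begin

definition integer_lattice :: "(real ^ 'd) set"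
  where "integer_lattice = {x. \<forall>j. x $ j \<in> \<int>}"

definition rational_polytope :: "(real ^ 'd) set \<Rightarrow> bool"
  where "rational_polytope P \<longleftrightarrow>
    polytope P \<and> (\<forall>v. v extreme_point_of P \<longrightarrow> (\<forall>j. v $ j \<in> \<rat>))"

text \<open>The number of lattice points in the real dilate of \<open>P\<close> by \<open>s \<ge> 0\<close>. The value at
  \<open>s = 0\<close> is a convention and applies to every \<open>P\<close>, including the empty polytope. For bounded
  \<open>P\<close> the set being counted is finite, so \<open>card\<close> is the true cardinality.\<close>
definition lattice_count :: "(real ^ 'd) set \<Rightarrow> real \<Rightarrow> nat"
  where "lattice_count P s =
    (if s = 0 then 1 else card ((\<lambda>x. s *\<^sub>R x) ` P \<inter> integer_lattice))"

definition semi_reflexive :: "(real ^ 'd) set \<Rightarrow> bool"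
  where "semi_reflexive P \<longleftrightarrow>
    rational_polytope P \<and> (\<forall>s\<ge>0. lattice_count P s = lattice_count P (real_of_int \<lfloor>s\<rfloor>))"

end

theory Submission
  imports Defs
begin

text \<open>
  A semi-reflexive polytope contains \<open>0\<close>, and the dilates \<open>sP\<close> are then nested, so the condition
  says that \<open>sP\<close> and \<open>\<lfloor>s\<rfloor>P\<close> contain the same lattice points (only \<open>0\<close> if \<open>s < 1\<close>). For
  integral \<open>a\<close> and \<open>x\<close>, and \<open>b \<in> {0, 1}\<close>, the inequality \<open>\<langle>a, x\<rangle> \<le> s b\<close> can be replaced by
  \<open>\<langle>a, x\<rangle> \<le> \<lfloor>s\<rfloor> b\<close>, which gives one direction. Conversely, normalise a facet not through the
  origin to \<open>\<langle>\<alpha>, x\<rangle> \<le> 1\<close>. A lattice point \<open>w\<close> in the cone over the facet lies in \<open>sP\<close> exactly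
  for \<open>s \<ge> \<langle>\<alpha>, w\<rangle>\<close>, so \<open>\<langle>\<alpha>, w\<rangle>\<close> is an integer; such points generate all lattice points of
  the linear hull \<open>L\<close>, on which \<open>\<alpha>\<close> is therefore integral, and an integral functional on
  \<open>L \<inter> \<int>^d\<close> extends to \<open>\<int>^d\<close>. Facets through the origin and the equations of \<open>L\<close> only need
  to be rational.
\<close>

section \<open>Closure properties and discreteness of the integer lattice\<close>

lemma integer_lattice_0 [simp]: "0 \<in> integer_lattice"
  by (simp add: integer_lattice_def)

lemma integer_lattice_add: "x \<in> integer_lattice \<Longrightarrow> y \<in> integer_lattice \<Longrightarrow> x + y \<in> integer_lattice"
  by (simp add: integer_lattice_def)

lemma integer_lattice_diff: "x \<in> integer_lattice \<Longrightarrow> y \<in> integer_lattice \<Longrightarrow> x - y \<in> integer_lattice"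
  by (simp add: integer_lattice_def)

lemma integer_lattice_scale: "c \<in> \<int> \<Longrightarrow> x \<in> integer_lattice \<Longrightarrow> c *\<^sub>R x \<in> integer_lattice"
  by (simp add: integer_lattice_def)

lemma integer_lattice_sum: "(\<And>i. i \<in> I \<Longrightarrow> f i \<in> integer_lattice) \<Longrightarrow> sum f I \<in> integer_lattice"
  by (induction I rule: infinite_finite_induct) (auto simp: integer_lattice_add)

lemma integer_lattice_axis: "axis j 1 \<in> integer_lattice"
  by (auto simp: integer_lattice_def axis_def)

lemma integer_lattice_inner:
  "x \<in> integer_lattice \<Longrightarrow> y \<in> integer_lattice \<Longrightarrow> x \<bullet> y \<in> \<int>"
  by (auto simp: integer_lattice_def inner_vec_def intro!: Ints_sum Ints_mult)

lemma finite_bounded_integer_lattice: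
  fixes A :: "(real ^ 'd) set"
  assumes "bounded A"
  shows "finite (A \<inter> integer_lattice)"
proof -
  obtain B where B: "\<And>x. x \<in> A \<Longrightarrow> norm x \<le> B"
    using assms by (auto simp: bounded_iff)
  have "x \<in> vec_lambda ` (UNIV \<rightarrow>\<^sub>E real_of_int ` {- \<lceil>B\<rceil>..\<lceil>B\<rceil>})"
    if x: "x \<in> A" "x \<in> integer_lattice" for x
  proof -
    have "x $ j \<in> real_of_int ` {- \<lceil>B\<rceil>..\<lceil>B\<rceil>}" for j
    proof -
      obtain k where k: "x $ j = of_int k"
        using x(2) by (auto simp: integer_lattice_def elim: Ints_cases)
      have "\<bar>x $ j\<bar> \<le> B"
        using component_le_norm_cart[of x j] B[OF x(1)] by linarith
      then have "k \<in> {- \<lceil>B\<rceil>..\<lceil>B\<rceil>}"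
        unfolding k by (auto simp: abs_le_iff) linarith+
      then show ?thesis
        by (auto simp: k)
    qed
    then show ?thesis
      by (intro image_eqI[of _ _ "vec_nth x"]) auto
  qed
  then have "A \<inter> integer_lattice \<subseteq> vec_lambda ` (UNIV \<rightarrow>\<^sub>E real_of_int ` {- \<lceil>B\<rceil>..\<lceil>B\<rceil>})"
    by blast
  then show ?thesis
    by (rule finite_subset) (auto intro!: finite_PiE)
qed

section \<open>Integral functionals on rational subspaces\<close>

text \<open>The values of \<open>u\<close> on the lattice points of the span form a group. Reduction
  modulo integer combinations of \<open>S\<close> shows that only finitely many of them lie in (0,
  \<open>u \<bullet> e\<close>], so the least positive one, taken at \<open>w\<close>, generates the
  group. Values are measured in units of \<open>u \<bullet> w\<close> because \<open>u\<close>
  itself may be irrational.\<close>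

lemma integer_functional_discrete:
  fixes u e :: "real ^ 'd"
  assumes S: "finite S" "S \<subseteq> integer_lattice" and e: "e \<in> integer_lattice"
    and uS: "\<And>s. s \<in> S \<Longrightarrow> u \<bullet> s = 0" and ue: "u \<bullet> e > 0"
  obtains w where "w \<in> span (insert e S)" "w \<in> integer_lattice" "u \<bullet> w > 0"
    "\<And>v. v \<in> span (insert e S) \<Longrightarrow> v \<in> integer_lattice \<Longrightarrow> u \<bullet> v / (u \<bullet> w) \<in> \<int>"
proof -
  define M where "M = span (insert e S) \<inter> integer_lattice"
  define D where "D = (\<lambda>v. u \<bullet> v) ` {v \<in> M. 0 < u \<bullet> v \<and> u \<bullet> v \<le> u \<bullet> e}"
  define R where "R = (\<Sum>s\<in>S. norm s) + norm e"
  have "D \<subseteq> (\<lambda>v. u \<bullet> v) ` (cball 0 R \<inter> integer_lattice)"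
  proof -
    have "u \<bullet> v \<in> (\<lambda>v. u \<bullet> v) ` (cball 0 R \<inter> integer_lattice)"
      if v: "v \<in> M" "0 < u \<bullet> v" "u \<bullet> v \<le> u \<bullet> e" for v
    proof -
      obtain c where c: "v - c *\<^sub>R e \<in> span S"
        using v(1) by (auto simp: M_def span_insert)
      obtain r where r: "v - c *\<^sub>R e = (\<Sum>s\<in>S. r s *\<^sub>R s)"
        using c S(1) by (auto simp: span_finite)
      have "u \<bullet> (v - c *\<^sub>R e) = 0"
        unfolding r by (simp add: inner_sum_right uS)
      then have uv: "u \<bullet> v = c * (u \<bullet> e)"
        by (simp add: inner_diff_right)
      have c01: "0 < c" "c \<le> 1"
        using v(2,3) ue unfolding uv by (auto simp: zero_less_mult_iff)
      \<comment> \<open>Removing integer parts keeps the point in the lattice and its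
        \<open>u\<close>-value unchanged, but leaves coefficients in [0, 1], hence norm at most
        \<open>R\<close>.\<close>
      define v' where "v' = v - (\<Sum>s\<in>S. of_int \<lfloor>r s\<rfloor> *\<^sub>R s)"
      have 1: "v' \<in> integer_lattice"
        unfolding v'_def using v(1) S(2)
        by (intro integer_lattice_diff integer_lattice_sum integer_lattice_scale) (auto simp: M_def)
      have 2: "u \<bullet> v' = u \<bullet> v"
        by (simp add: v'_def inner_diff_right inner_sum_right uS)
      have "v' = (\<Sum>s\<in>S. frac (r s) *\<^sub>R s) + c *\<^sub>R e"
        using r by (simp add: v'_def frac_def scaleR_diff_left sum_subtractf algebra_simps)
      then have "norm v' \<le> (\<Sum>s\<in>S. norm (frac (r s) *\<^sub>R s)) + norm (c *\<^sub>R e)"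
        by (simp only:) (intro order_trans[OF norm_triangle_ineq] add_mono norm_sum order_refl)
      also have "\<dots> \<le> R"
        unfolding R_def using c01
        by (intro add_mono sum_mono)
           (auto intro!: mult_left_le_one_le simp: frac_ge_0 less_imp_le[OF frac_lt_1])
      finally show ?thesis
        using 1 2 by (intro image_eqI[of _ _ v']) auto
    qed
    then show ?thesis
      by (auto simp: D_def)
  qed
  then have "finite D"
    by (rule finite_subset) (auto intro!: finite_imageI finite_bounded_integer_lattice)
  moreover have "u \<bullet> e \<in> D"
    using e ue by (auto simp: D_def M_def span_base)
  ultimately have "Min D \<in> D"
    by (intro Min_in) auto
  then obtain w where w: "w \<in> M" "0 < u \<bullet> w" "u \<bullet> w \<le> u \<bullet> e" "u \<bullet> w = Min D"
    by (auto simp: D_def)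
  have "u \<bullet> v / (u \<bullet> w) \<in> \<int>" if v: "v \<in> M" for v
  proof -
    \<comment> \<open>Division with remainder: the value at \<open>v'\<close> lies in [0,
      \<open>u \<bullet> w\<close>), so minimality forces it to be 0.\<close>
    define q where "q = \<lfloor>u \<bullet> v / (u \<bullet> w)\<rfloor>"
    define v' where "v' = v - of_int q *\<^sub>R w"
    have v'M: "v' \<in> M"
      using v w(1) unfolding v'_def M_def
      by (auto intro!: span_diff span_scale integer_lattice_diff integer_lattice_scale)
    have uv': "u \<bullet> v' = u \<bullet> v - of_int q * (u \<bullet> w)"
      by (simp add: v'_def inner_diff_right)
    have "of_int q \<le> u \<bullet> v / (u \<bullet> w)" "u \<bullet> v / (u \<bullet> w) < of_int q + 1"
      unfolding q_def by linarith+
    then have "0 \<le> u \<bullet> v'" "u \<bullet> v' < u \<bullet> w"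
      using w(2) by (auto simp: uv' field_simps)
    moreover have "\<not> 0 < u \<bullet> v'"
    proof
      assume "0 < u \<bullet> v'"
      then have "u \<bullet> v' \<in> D"
        using v'M \<open>u \<bullet> v' < u \<bullet> w\<close> w(3) by (auto simp: D_def)
      then show False
        using \<open>finite D\<close> \<open>u \<bullet> v' < u \<bullet> w\<close> w(4) Min_le by fastforce
    qed
    ultimately have "u \<bullet> v / (u \<bullet> w) = of_int q"
      using w(2) uv' by (simp add: field_simps)
    then show ?thesis
      by simp
  qed
  with w show ?thesis
    by (intro that[of w]) (auto simp: M_def)
qed

text \<open>Induction on the codimension of \<open>span S\<close>: while the span is proper, some
  unit vector \<open>e\<close> lies outside it, detected by a normal vector \<open>u\<close>. A
  property is proved for the whole space and then passed down one dimension at a time.\<close>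

lemma span_axis_induct [consumes 2, case_names UNIV insert]:
  fixes S :: "(real ^ 'd) set"
  assumes "finite S" "S \<subseteq> integer_lattice"
    and top: "\<And>S. finite S \<Longrightarrow> S \<subseteq> integer_lattice \<Longrightarrow> span S = UNIV \<Longrightarrow> Q S"
    and step: "\<And>S u e. finite S \<Longrightarrow> S \<subseteq> integer_lattice \<Longrightarrow> e \<in> integer_lattice \<Longrightarrow>
      (\<And>x. x \<in> span S \<Longrightarrow> u \<bullet> x = 0) \<Longrightarrow> u \<bullet> e > 0 \<Longrightarrow> Q (insert e S) \<Longrightarrow> Q S"
  shows "Q S"
  using assms(1,2)
proof (induction "DIM(real ^ 'd) - dim S" arbitrary: S rule: less_induct)
  case less
  show ?case
  proof (cases "dim S < DIM(real ^ 'd)")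
    case False
    then have "span S = UNIV"
      by (metis dim_eq_full dim_subset_UNIV le_neq_implies_less)
    then show ?thesis
      using less top by blast
  next
    case True
    then obtain x where x: "x \<noteq> 0" "\<And>y. y \<in> span S \<Longrightarrow> orthogonal x y"
      using orthogonal_to_subspace_exists by blast
    then obtain j where j: "x $ j \<noteq> 0"
      by (auto simp: vec_eq_iff)
    define u where "u = (1 / x $ j) *\<^sub>R x"
    have uS: "u \<bullet> y = 0" if "y \<in> span S" for y
      using x(2)[OF that] by (simp add: u_def orthogonal_def)
    have uj: "u \<bullet> axis j 1 = 1"
      using j by (simp add: u_def inner_axis)
    then have "axis j 1 \<notin> span S"
      using uS by force
    then have "dim (insert (axis j 1) S) = dim S + 1"
      by (simp add: dim_insert)
    then have "Q (insert (axis j 1) S)"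
      using less True integer_lattice_axis by (intro less.hyps) auto
    then show ?thesis
      using uj uS less.prems integer_lattice_axis by (intro step[of S "axis j 1" u]) auto
  qed
qed

text \<open>Lattice points of a rational subspace form a direct summand of the integer lattice.\<close>

lemma integral_functional_extends:
  fixes S :: "(real ^ 'd) set"
  assumes "finite S" "S \<subseteq> integer_lattice"
    and "\<And>v. v \<in> span S \<Longrightarrow> v \<in> integer_lattice \<Longrightarrow> a \<bullet> v \<in> \<int>"
  shows "\<exists>a'\<in>integer_lattice. \<forall>v\<in>span S. a' \<bullet> v = a \<bullet> v"
  using assms
proof (induction S arbitrary: a rule: span_axis_induct)
  case (UNIV S)
  have "a $ j \<in> \<int>" for j
    using UNIV(4)[of "axis j 1"] integer_lattice_axis UNIV(3) by (auto simp: inner_axis)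
  then show ?case
    by (intro bexI[of _ a]) (auto simp: integer_lattice_def)
next
  case (insert S u e)
  have "u \<bullet> s = 0" if "s \<in> S" for s
    using insert that by (simp add: span_base)
  from integer_functional_discrete[OF insert(1,2,3) this insert(5)]
  obtain w where w: "w \<in> span (insert e S)" "w \<in> integer_lattice" "u \<bullet> w > 0"
    "\<And>v. v \<in> span (insert e S) \<Longrightarrow> v \<in> integer_lattice \<Longrightarrow> u \<bullet> v / (u \<bullet> w) \<in> \<int>"
    by blast
  \<comment> \<open>The multiple of \<open>u\<close> is chosen so that
    \<open>f \<bullet> w = 0\<close>; on \<open>span S\<close>, where \<open>u\<close> vanishes,
    \<open>f\<close> still agrees with \<open>a\<close>.\<close>
  define f where "f = a - (a \<bullet> w / (u \<bullet> w)) *\<^sub>R u"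
  have fS: "f \<bullet> v = a \<bullet> v" if "v \<in> span S" for v
    using insert(4)[OF that] by (simp add: f_def inner_diff_left)
  have "f \<bullet> v \<in> \<int>" if v: "v \<in> span (insert e S)" "v \<in> integer_lattice" for v
  proof -
    \<comment> \<open>\<open>v\<close> is an integer multiple of \<open>w\<close> plus a lattice
      point \<open>y\<close> with \<open>u \<bullet> y = 0\<close>; such a \<open>y\<close> lies in
      \<open>span S\<close>, where \<open>a\<close> is integral.\<close>
    define m where "m = u \<bullet> v / (u \<bullet> w)"
    define y where "y = v - m *\<^sub>R w"
    have m: "m \<in> \<int>"
      using w(4)[OF v] by (simp add: m_def)
    have y: "y \<in> span (insert e S)" "y \<in> integer_lattice"
      using v w(1,2) m unfolding y_def
      by (auto intro!: span_diff span_scale integer_lattice_diff integer_lattice_scale)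
    have uy: "u \<bullet> y = 0"
      using w(3) by (simp add: y_def m_def inner_diff_right)
    obtain c where c: "y - c *\<^sub>R e \<in> span S"
      using y(1) by (auto simp: span_insert)
    have "c * (u \<bullet> e) = 0"
      using insert(4)[OF c] uy by (simp add: inner_diff_right)
    then have "y \<in> span S"
      using c insert(5) by simp
    then have "a \<bullet> y \<in> \<int>"
      using insert(7) y by blast
    moreover have "f \<bullet> v = a \<bullet> y"
      using w(3) by (simp add: f_def y_def m_def inner_diff_left inner_diff_right)
    ultimately show ?thesis
      by simp
  qed
  then obtain a' where "a' \<in> integer_lattice" "\<forall>v\<in>span (insert e S). a' \<bullet> v = f \<bullet> v"
    using insert(6) by blast
  then show ?case
    using fS span_mono[of S "insert e S"]
    by (intro bexI[of _ a']) (metis subset_insertI subsetD, assumption)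
qed

text \<open>The subspace is cut out one equation at a time. Divided by \<open>u \<bullet> w\<close>,
  the normal vector \<open>u\<close> is integral on the lattice points of the larger span and
  extends to an integer vector \<open>c\<close>; the inequalities for \<open>c\<close> and
  \<open>- c\<close> together say that \<open>u\<close> vanishes.\<close>

lemma integer_span_eq_halfspaces:
  fixes S :: "(real ^ 'd) set"
  assumes "finite S" "S \<subseteq> integer_lattice"
  shows "\<exists>C. finite C \<and> C \<subseteq> integer_lattice \<and> span S = {x. \<forall>c\<in>C. c \<bullet> x \<le> 0}"
  using assms
proof (induction S rule: span_axis_induct)
  case (UNIV S)
  then show ?case
    by (intro exI[of _ "{}"]) auto
next
  case (insert S u e)
  obtain C where C: "finite C" "C \<subseteq> integer_lattice" "span (insert e S) = {x. \<forall>c\<in>C. c \<bullet> x \<le> 0}"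
    using insert by blast
  have "u \<bullet> s = 0" if "s \<in> S" for s
    using insert that by (simp add: span_base)
  from integer_functional_discrete[OF insert(1,2,3) this insert(5)]
  obtain w where w: "w \<in> integer_lattice" "u \<bullet> w > 0"
    "\<And>v. v \<in> span (insert e S) \<Longrightarrow> v \<in> integer_lattice \<Longrightarrow> u \<bullet> v / (u \<bullet> w) \<in> \<int>"
    by blast
  have "\<exists>c\<in>integer_lattice. \<forall>v\<in>span (insert e S). c \<bullet> v = ((1 / (u \<bullet> w)) *\<^sub>R u) \<bullet> v"
    using insert w(3) by (intro integral_functional_extends) auto
  then obtain c where c: "c \<in> integer_lattice"
    "\<And>v. v \<in> span (insert e S) \<Longrightarrow> c \<bullet> v = u \<bullet> v / (u \<bullet> w)"
    by auto
  have "x \<in> span S \<longleftrightarrow> x \<in> span (insert e S) \<and> c \<bullet> x \<le> 0 \<and> (- c) \<bullet> x \<le> 0" for x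
  proof
    assume "x \<in> span S"
    moreover from this have "x \<in> span (insert e S)"
      using span_mono[of S "insert e S"] by auto
    ultimately show "x \<in> span (insert e S) \<and> c \<bullet> x \<le> 0 \<and> (- c) \<bullet> x \<le> 0"
      using c(2) insert(4) by simp
  next
    assume x: "x \<in> span (insert e S) \<and> c \<bullet> x \<le> 0 \<and> (- c) \<bullet> x \<le> 0"
    then have ux: "u \<bullet> x = 0"
      using c(2)[of x] w(2) by (auto simp: field_simps)
    obtain t where t: "x - t *\<^sub>R e \<in> span S"
      using x by (auto simp: span_insert)
    have "t * (u \<bullet> e) = 0"
      using insert(4)[OF t] ux by (simp add: inner_diff_right)
    then show "x \<in> span S"
      using t insert(5) by simp
  qed
  then have "span S = {x. \<forall>d \<in> C \<union> {c, - c}. d \<bullet> x \<le> 0}"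
    unfolding C(3) by auto
  moreover have "- c \<in> integer_lattice"
    using c(1) by (simp add: integer_lattice_def)
  ultimately show ?case
    using C(1,2) c(1) by (intro exI[of _ "C \<union> {c, - c}"]) auto
qed

section \<open>Lattice points in dilates of a semi-reflexive polytope\<close>

lemma mem_scaleR_image_iff:
  fixes x :: "'a::real_vector"
  assumes "s > 0"
  shows "x \<in> (\<lambda>x. s *\<^sub>R x) ` P \<longleftrightarrow> (1 / s) *\<^sub>R x \<in> P"
proof
  assume "(1 / s) *\<^sub>R x \<in> P"
  then show "x \<in> (\<lambda>x. s *\<^sub>R x) ` P"
    using assms by (intro image_eqI[of _ _ "(1 / s) *\<^sub>R x"]) auto
qed (use assms in auto)

lemma integer_lattice_norm_less_1:
  assumes "x \<in> integer_lattice" "norm x < 1"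
  shows "x = 0"
proof -
  have "x $ j = 0" for j
  proof -
    have "x $ j \<in> \<int>" "\<bar>x $ j\<bar> < 1"
      using assms component_le_norm_cart[of x j] by (auto simp: integer_lattice_def)
    then show ?thesis
      using Ints_nonzero_abs_less1 by blast
  qed
  then show ?thesis
    by (simp add: vec_eq_iff)
qed

lemma semi_reflexive_bounded: "semi_reflexive P \<Longrightarrow> bounded P"
  by (simp add: semi_reflexive_def rational_polytope_def polytope_imp_bounded)

lemma semi_reflexive_convex: "semi_reflexive P \<Longrightarrow> convex P"
  by (simp add: semi_reflexive_def rational_polytope_def polytope_imp_convex)

lemma semi_reflexive_card:
  assumes "semi_reflexive P" "s > 0"
  shows "card ((\<lambda>x. s *\<^sub>R x) ` P \<inter> integer_lattice) = lattice_count P (of_int \<lfloor>s\<rfloor>)"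
proof -
  have "card ((\<lambda>x. s *\<^sub>R x) ` P \<inter> integer_lattice) = lattice_count P s"
    using assms(2) by (simp add: lattice_count_def)
  also have "\<dots> = lattice_count P (of_int \<lfloor>s\<rfloor>)"
    using assms unfolding semi_reflexive_def by (metis less_imp_le)
  finally show ?thesis .
qed

text \<open>A small enough dilate lies in the open unit ball, where 0 is the only lattice point,
  while its count must equal the conventional value 1.\<close>

lemma semi_reflexive_zero_mem:
  assumes "semi_reflexive P"
  shows "0 \<in> P"
proof -
  obtain B where B: "B > 0" "\<And>x. x \<in> P \<Longrightarrow> norm x \<le> B"
    using semi_reflexive_bounded[OF assms] by (auto simp: bounded_pos)
  define s where "s = 1 / (B + 1)"
  have s: "0 < s" "s < 1"
    using B(1) by (auto simp: s_def)
  then have "\<lfloor>s\<rfloor> = 0"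
    by linarith
  then have "card ((\<lambda>x. s *\<^sub>R x) ` P \<inter> integer_lattice) = 1"
    using semi_reflexive_card[OF assms s(1)] by (simp add: lattice_count_def)
  then have "(\<lambda>x. s *\<^sub>R x) ` P \<inter> integer_lattice \<noteq> {}"
    by force
  then obtain x where x: "x \<in> P" "s *\<^sub>R x \<in> integer_lattice"
    by blast
  have "norm (s *\<^sub>R x) < 1"
    using B(1) B(2)[OF x(1)] by (simp add: s_def)
  then have "s *\<^sub>R x = 0"
    using x(2) integer_lattice_norm_less_1 by blast
  then show ?thesis
    using s x(1) by auto
qed

text \<open>The dilates by \<open>s\<close> and by its floor are nested and have equally many
  lattice points, hence the same ones. So \<open>w\<close> lies in the smaller dilate, on which
  \<alpha> is at most the floor.\<close>

lemma semi_reflexive_functional_le_floor: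
  fixes P :: "(real ^ 'd) set"
  assumes P: "semi_reflexive P" and \<alpha>: "\<And>x. x \<in> P \<Longrightarrow> \<alpha> \<bullet> x \<le> 1"
    and s: "s > 0" and w: "w \<in> integer_lattice" "(1 / s) *\<^sub>R w \<in> P"
  shows "\<alpha> \<bullet> w \<le> of_int \<lfloor>s\<rfloor>"
proof -
  define Q where "Q t = (\<lambda>x. t *\<^sub>R x) ` P \<inter> integer_lattice" for t :: real
  have finite_Q: "finite (Q t)" for t
    unfolding Q_def
    by (intro finite_bounded_integer_lattice bounded_scaling semi_reflexive_bounded P)
  have wQ: "w \<in> Q s"
    using w mem_scaleR_image_iff[OF s, THEN iffD2] by (auto simp: Q_def)
  have Q_card: "card (Q s) = lattice_count P (of_int \<lfloor>s\<rfloor>)"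
    using semi_reflexive_card[OF P s] by (simp add: Q_def)
  have P0: "0 \<in> P"
    by (rule semi_reflexive_zero_mem[OF P])
  show ?thesis
  proof (cases "\<lfloor>s\<rfloor> = 0")
    \<comment> \<open>Here the count is the conventional 1, already used up by the origin.\<close>
    case True
    then have "card (Q s) = 1"
      using Q_card by (simp add: lattice_count_def)
    moreover have "0 \<in> Q s"
      using P0 by (force simp: Q_def)
    ultimately have "w = 0"
      using wQ by (auto simp: card_1_singleton_iff)
    then show ?thesis
      using True by simp
  next
    case False
    define t where "t = real_of_int \<lfloor>s\<rfloor>"
    have t: "0 < t" "t \<le> s"
      using s False by (auto simp: t_def) linarith
    have "Q t \<subseteq> Q s"
    proof
      fix x assume x: "x \<in> Q t"
      then have "(1 / t) *\<^sub>R x \<in> P"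
        using mem_scaleR_image_iff[OF t(1)] by (auto simp: Q_def)
      \<comment> \<open>\<open>x / s\<close> lies on the segment from the origin to
        \<open>x / t\<close>.\<close>
      then have "(t / s) *\<^sub>R (1 / t) *\<^sub>R x + (1 - t / s) *\<^sub>R 0 \<in> P"
        using t s P0 by (intro convexD[OF semi_reflexive_convex[OF P]]) auto
      then show "x \<in> Q s"
        using x t mem_scaleR_image_iff[OF s] by (auto simp: Q_def)
    qed
    moreover have "card (Q t) = card (Q s)"
      using Q_card False by (simp add: Q_def lattice_count_def t_def)
    ultimately have "w \<in> Q t"
      using wQ finite_Q card_subset_eq by metis
    then have "(1 / t) *\<^sub>R w \<in> P"
      using mem_scaleR_image_iff[OF t(1)] by (auto simp: Q_def)
    then have "\<alpha> \<bullet> ((1 / t) *\<^sub>R w) \<le> 1"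
      by (rule \<alpha>)
    then show ?thesis
      using t by (simp add: t_def[symmetric] field_simps)
  qed
qed

section \<open>Integral halfspaces with offsets 0 and 1 give semi-reflexivity\<close>

text \<open>For \<open>s \<ge> 1\<close> integer values can be compared with floors instead. For
  \<open>0 < s < 1\<close> the count at the floor is the convention 1, so it must be shown that the
  dilate has 0 as its only lattice point; this uses boundedness.\<close>

lemma semi_reflexive_if_halfspaces:
  fixes a :: "'i \<Rightarrow> real ^ 'd"
  assumes P: "rational_polytope P"
    and ab: "\<And>i. i \<in> I \<Longrightarrow> a i \<in> integer_lattice \<and> b i \<in> {0, 1}"
    and eq: "P = (\<Inter>i\<in>I. {x. a i \<bullet> x \<le> b i})"
  shows "semi_reflexive P"
proof -
  have bnd: "bounded P"
    using P by (simp add: rational_polytope_def polytope_imp_bounded)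
  have mem: "x \<in> (\<lambda>x. s *\<^sub>R x) ` P \<longleftrightarrow> (\<forall>i\<in>I. a i \<bullet> x \<le> s * b i)" if "s > 0" for x s
    using that by (simp add: mem_scaleR_image_iff) (auto simp: eq field_simps)
  have floor_mem: "(\<forall>i\<in>I. a i \<bullet> x \<le> s * b i) \<longleftrightarrow> (\<forall>i\<in>I. a i \<bullet> x \<le> of_int \<lfloor>s\<rfloor> * b i)"
    if "x \<in> integer_lattice" for x s
  proof (intro ball_cong refl)
    fix i assume i: "i \<in> I"
    then have "a i \<bullet> x \<in> \<int>"
      using ab that by (auto intro: integer_lattice_inner)
    then obtain k where "a i \<bullet> x = of_int k"
      by (rule Ints_cases)
    then show "a i \<bullet> x \<le> s * b i \<longleftrightarrow> a i \<bullet> x \<le> of_int \<lfloor>s\<rfloor> * b i"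
      using ab[OF i] by (auto simp: le_floor_iff)
  qed
  have "lattice_count P s = lattice_count P (of_int \<lfloor>s\<rfloor>)" if s: "s \<ge> 0" for s
  proof (cases "s = 0 \<or> \<lfloor>s\<rfloor> \<noteq> 0")
    case True
    then show ?thesis
    proof
      assume "\<lfloor>s\<rfloor> \<noteq> 0"
      then have "s > 0" "real_of_int \<lfloor>s\<rfloor> > 0"
        using s by (cases "s = 0"; linarith)+
      then have "(\<lambda>x. s *\<^sub>R x) ` P \<inter> integer_lattice =
          (\<lambda>x. real_of_int \<lfloor>s\<rfloor> *\<^sub>R x) ` P \<inter> integer_lattice"
        using mem floor_mem by blast
      then show ?thesis
        using \<open>s > 0\<close> \<open>\<lfloor>s\<rfloor> \<noteq> 0\<close> by (simp add: lattice_count_def)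
    qed simp
  next
    case False
    then have s: "s > 0" "\<lfloor>s\<rfloor> = 0"
      using s by auto
    have "x = 0" if x: "x \<in> (\<lambda>x. s *\<^sub>R x) ` P" "x \<in> integer_lattice" for x
    proof (rule ccontr)
      assume "x \<noteq> 0"
      \<comment> \<open>With floor 0 every right-hand side becomes 0, so a nonzero \<open>x\<close>
        would span a ray inside \<open>P\<close>.\<close>
      have le: "a i \<bullet> x \<le> 0" if "i \<in> I" for i
        using mem[OF s(1)] floor_mem[OF x(2), of s] x(1) s(2) that by auto
      have ray: "t *\<^sub>R x \<in> P" if "t \<ge> 0" for t
      proof -
        have "t * (a i \<bullet> x) \<le> b i" if "i \<in> I" for i
          using mult_nonneg_nonpos[OF \<open>t \<ge> 0\<close> le[OF that]] ab[OF that] by auto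
        then show ?thesis
          by (auto simp: eq)
      qed
      obtain B where B: "B > 0" "\<And>x. x \<in> P \<Longrightarrow> norm x \<le> B"
        using bnd by (auto simp: bounded_pos)
      have "norm (((B + 1) / norm x) *\<^sub>R x) \<le> B"
        using B(1) by (intro B(2) ray) auto
      then show False
        using \<open>x \<noteq> 0\<close> B(1) by simp
    qed
    moreover have "0 \<in> (\<lambda>x. s *\<^sub>R x) ` P"
      using s(1) ab by (fastforce simp: mem)
    ultimately have "(\<lambda>x. s *\<^sub>R x) ` P \<inter> integer_lattice = {0}"
      by auto
    then show ?thesis
      using s by (simp add: lattice_count_def)
  qed
  then show ?thesis
    using P unfolding semi_reflexive_def by blast
qed

section \<open>Supporting hyperplanes and common denominators\<close>

text \<open>The weighted slacks \<open>u v * (b - a \<bullet> v)\<close> of a convex combination for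
  \<open>q\<close> are nonnegative and sum to 0, so no weight sits off the hyperplane.\<close>

lemma convex_hull_Int_supporting_hyperplane:
  fixes V :: "'a::real_inner set"
  assumes V: "finite V" and q: "q \<in> convex hull V"
    and le: "\<And>v. v \<in> V \<Longrightarrow> a \<bullet> v \<le> b" and aq: "a \<bullet> q = b"
  shows "q \<in> convex hull {v \<in> V. a \<bullet> v = b}"
proof -
  obtain u where u: "\<And>v. v \<in> V \<Longrightarrow> 0 \<le> u v" "sum u V = 1" "(\<Sum>v\<in>V. u v *\<^sub>R v) = q"
    using q by (auto simp: convex_hull_finite[OF V])
  have "(\<Sum>v\<in>V. u v * (b - a \<bullet> v)) = b * sum u V - a \<bullet> (\<Sum>v\<in>V. u v *\<^sub>R v)"
    by (simp add: inner_sum_right right_diff_distrib sum_subtractf sum_distrib_left mult.commute)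
  also have "\<dots> = 0"
    by (simp add: u aq)
  finally have "\<forall>v\<in>V. u v * (b - a \<bullet> v) = 0"
    using u(1) le by (subst (asm) sum_nonneg_eq_0_iff[OF V]) auto
  then have zero: "u v = 0" if "v \<in> V - {v \<in> V. a \<bullet> v = b}" for v
    using that by auto
  let ?W = "{v \<in> V. a \<bullet> v = b}"
  have "sum u ?W = sum u V" "(\<Sum>v\<in>?W. u v *\<^sub>R v) = (\<Sum>v\<in>V. u v *\<^sub>R v)"
    using V zero by (intro sum.mono_neutral_left; simp)+
  then have "sum u ?W = 1" "(\<Sum>v\<in>?W. u v *\<^sub>R v) = q"
    by (simp_all add: u)
  then show ?thesis
    using u(1) V by (auto simp: convex_hull_finite)
qed

lemma rational_common_denominator:
  fixes V :: "(real ^ 'd) set"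
  assumes "finite V" "\<And>v j. v \<in> V \<Longrightarrow> v $ j \<in> \<rat>"
  shows "\<exists>N::nat. N > 0 \<and> (\<forall>v\<in>V. real N *\<^sub>R v \<in> integer_lattice)"
proof -
  have rat: "\<exists>m::nat. m > 0 \<and> real m * r \<in> \<int>" if r: "r \<in> \<rat>" for r
  proof -
    obtain p :: int and q :: nat where "q \<noteq> 0" "r = of_int p / of_nat q"
      using r by (auto simp: Rats_eq_int_div_nat)
    then show ?thesis
      by (intro exI[of _ q]) auto
  qed
  define m where "m r = (SOME m::nat. m > 0 \<and> real m * r \<in> \<int>)" for r
  have m: "m r > 0" "real (m r) * r \<in> \<int>" if "r \<in> \<rat>" for r
    using someI_ex[OF rat[OF that]] by (auto simp: m_def)
  \<comment> \<open>One denominator for each coordinate of each point; every one divides the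
    product.\<close>
  define N where "N = (\<Prod>p\<in>V \<times> UNIV. m (fst p $ snd p))"
  have "real N * (v $ j) \<in> \<int>" if v: "v \<in> V" for v j
  proof -
    have "m (fst (v, j) $ snd (v, j)) dvd N"
      unfolding N_def using v assms(1) by (intro dvd_prodI) auto
    then obtain k where "N = m (v $ j) * k"
      by (auto elim: dvdE)
    then have "real N * (v $ j) = real k * (real (m (v $ j)) * (v $ j))"
      by simp
    also have "\<dots> \<in> \<int>"
      by (rule Ints_mult[OF Ints_of_nat m(2)[OF assms(2)[OF v]]])
    finally show ?thesis .
  qed
  moreover have "N > 0"
    unfolding N_def by (intro prod_pos m(1) assms(2)) auto
  ultimately show ?thesis
    by (intro exI[of _ N]) (auto simp: integer_lattice_def)
qed

section \<open>Cones over the facets of an irredundantly described polytope\<close>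

text \<open>\<open>V\<close> stands for the vertices and \<open>F\<close> indexes the facet
  inequalities. As the origin belongs to the polytope, its affine hull is \<open>span V\<close>.
  Irredundancy is stated through a point violating just one inequality, the form that yields a point
  interior to each facet; \<open>N\<close> clears denominators.\<close>

locale irredundant_polytope =
  fixes V :: "(real ^ 'd) set" and F :: "'i set" and a :: "'i \<Rightarrow> real ^ 'd" and b :: "'i \<Rightarrow> real"
    and N :: nat
  assumes finite_V: "finite V" and zero_mem: "0 \<in> convex hull V" and finite_F: "finite F"
    and hull_eq: "convex hull V = {x \<in> span V. \<forall>h\<in>F. a h \<bullet> x \<le> b h}"
    and irredundant: "\<And>h. h \<in> F \<Longrightarrow>
      \<exists>y\<in>span V. b h < a h \<bullet> y \<and> (\<forall>g\<in>F - {h}. a g \<bullet> y \<le> b g)"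
    and strict_point: "\<exists>x\<in>convex hull V. \<forall>h\<in>F. a h \<bullet> x < b h"
    and N_pos: "N > 0" and N_integral: "\<And>v. v \<in> V \<Longrightarrow> real N *\<^sub>R v \<in> integer_lattice"
begin

definition facet_verts :: "'i \<Rightarrow> (real ^ 'd) set"
  where "facet_verts h = {v \<in> V. a h \<bullet> v = b h}"

text \<open>For a facet, this is \<open>facet_height h\<close> times the average of its vertices: a
  lattice point interior to the cone over it.\<close>

definition facet_vec :: "'i \<Rightarrow> real ^ 'd"
  where "facet_vec h = real N *\<^sub>R \<Sum>(facet_verts h)"

text \<open>The dilation factor that puts \<open>facet_vec h\<close> on the dilated facet.\<close>

definition facet_height :: "'i \<Rightarrow> real"
  where "facet_height h = real N * real (card (facet_verts h))"

lemma b_nonneg: "h \<in> F \<Longrightarrow> 0 \<le> b h"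
  using zero_mem unfolding hull_eq by auto

lemma vertex_le: "h \<in> F \<Longrightarrow> v \<in> V \<Longrightarrow> a h \<bullet> v \<le> b h"
  using hull_inc[of v V convex] unfolding hull_eq by auto

lemma finite_facet_verts [simp]: "finite (facet_verts h)"
  using finite_V by (simp add: facet_verts_def)

lemma mem_hull_facet_verts:
  "h \<in> F \<Longrightarrow> q \<in> convex hull V \<Longrightarrow> a h \<bullet> q = b h \<Longrightarrow> q \<in> convex hull (facet_verts h)"
  unfolding facet_verts_def
  using convex_hull_Int_supporting_hyperplane[OF finite_V] vertex_le by blast

text \<open>The segment from a strict point \<open>x\<close> to a point \<open>y\<close> beyond
  \<open>h\<close> alone meets the hyperplane of \<open>h\<close> where all other inequalities are
  still strict.\<close>

lemma facet_point:
  assumes h: "h \<in> F"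
  shows "\<exists>p\<in>convex hull (facet_verts h). \<forall>g\<in>F - {h}. a g \<bullet> p < b g"
proof -
  obtain y where y: "y \<in> span V" "b h < a h \<bullet> y" "\<And>g. g \<in> F - {h} \<Longrightarrow> a g \<bullet> y \<le> b g"
    using irredundant[OF h] by blast
  obtain x where x: "x \<in> convex hull V" "\<And>g. g \<in> F \<Longrightarrow> a g \<bullet> x < b g"
    using strict_point by blast
  define t where "t = (b h - a h \<bullet> x) / (a h \<bullet> y - a h \<bullet> x)"
  have t: "0 < t" "t < 1"
    using x(2)[OF h] y(2) by (auto simp: t_def field_simps)
  define p where "p = (1 - t) *\<^sub>R x + t *\<^sub>R y"
  have ap: "a g \<bullet> p = (1 - t) * (a g \<bullet> x) + t * (a g \<bullet> y)" for g
    by (simp add: p_def inner_add_right)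
  have "t * (a h \<bullet> y - a h \<bullet> x) = b h - a h \<bullet> x"
    using x(2)[OF h] y(2) by (simp add: t_def)
  then have ph: "a h \<bullet> p = b h"
    by (simp add: ap algebra_simps)
  have pg: "a g \<bullet> p < b g" if g: "g \<in> F - {h}" for g
  proof -
    have "(1 - t) * (a g \<bullet> x) < (1 - t) * b g"
      using t g x(2)[of g] by simp
    moreover have "t * (a g \<bullet> y) \<le> t * b g"
      using t y(3)[OF g] by simp
    ultimately show ?thesis
      by (simp add: ap algebra_simps)
  qed
  have "p \<in> span V"
    using x(1) y(1) unfolding p_def hull_eq by (auto intro: span_add span_scale)
  then have "p \<in> convex hull V"
    unfolding hull_eq using ph pg by (force intro: less_imp_le)
  then show ?thesis
    using pg mem_hull_facet_verts[OF h _ ph] by blast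
qed

lemma facet_vec_span: "facet_vec h \<in> span V"
  unfolding facet_vec_def facet_verts_def by (intro span_scale span_sum span_base) auto

lemma facet_vec_integral: "facet_vec h \<in> integer_lattice"
  unfolding facet_vec_def scaleR_sum_right
  by (intro integer_lattice_sum N_integral) (auto simp: facet_verts_def)

lemma facet_height_pos:
  assumes "h \<in> F"
  shows "facet_height h > 0"
proof -
  have "facet_verts h \<noteq> {}"
    using facet_point[OF assms] by force
  then show ?thesis
    using N_pos by (simp add: facet_height_def card_gt_0_iff)
qed

lemma inner_facet_vec: "a h \<bullet> facet_vec h = facet_height h * b h"
proof -
  have "a h \<bullet> facet_vec h = real N * (\<Sum>v\<in>facet_verts h. a h \<bullet> v)"
    by (simp add: facet_vec_def inner_sum_right)
  also have "(\<Sum>v\<in>facet_verts h. a h \<bullet> v) = (\<Sum>v\<in>facet_verts h. b h)"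
    by (intro sum.cong) (auto simp: facet_verts_def)
  finally show ?thesis
    by (simp add: facet_height_def)
qed

text \<open>If all vertices on \<open>h\<close> also lay on the hyperplane of \<open>g\<close>, so
  would the point from \<open>facet_point\<close>. One strict vertex makes the sum strict.\<close>

lemma inner_facet_vec_less:
  assumes h: "h \<in> F" and g: "g \<in> F - {h}"
  shows "a g \<bullet> facet_vec h < facet_height h * b g"
proof -
  obtain p where p: "p \<in> convex hull (facet_verts h)" "a g \<bullet> p < b g"
    using facet_point[OF h] g by blast
  have "\<exists>v\<in>facet_verts h. a g \<bullet> v < b g"
  proof (rule ccontr)
    assume "\<not> ?thesis"
    then have "convex hull (facet_verts h) \<subseteq> {x. a g \<bullet> x \<ge> b g}"
      by (intro hull_minimal convex_halfspace_ge) (auto simp: not_less)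
    then show False
      using p by auto
  qed
  then have "(\<Sum>v\<in>facet_verts h. a g \<bullet> v) < (\<Sum>v\<in>facet_verts h. b g)"
    using g by (intro sum_strict_mono_ex1) (auto simp: facet_verts_def finite_V intro: vertex_le)
  then have "real N * (\<Sum>v\<in>facet_verts h. a g \<bullet> v) < real N * (real (card (facet_verts h)) * b g)"
    using N_pos by simp
  then show ?thesis
    by (simp add: facet_vec_def facet_height_def inner_sum_right mult.assoc)
qed

text \<open>Moving far enough in the direction of the facet vector brings every point of the
  linear hull into the cone over the facet.\<close>

lemma eventually_mem_dilate:
  assumes h: "h \<in> F" and y: "y \<in> span V" "a h \<bullet> y \<le> c * b h"
  shows "\<forall>\<^sub>F k in sequentially. 0 < c + real k * facet_height h \<and>
    (1 / (c + real k * facet_height h)) *\<^sub>R (y + real k *\<^sub>R facet_vec h) \<in> convex hull V"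
proof -
  have arch: "\<forall>\<^sub>F k in sequentially. r < real k * d" if "d > 0" for r d :: real
  proof -
    obtain n :: nat where n: "r / d < real n"
      using reals_Archimedean2 by blast
    have "r < real k * d" if "n \<le> k" for k
      using n \<open>d > 0\<close> that by (simp add: divide_less_eq) (smt (verit) mult_right_mono of_nat_le_iff)
    then show ?thesis
      by (intro eventually_sequentiallyI[of n])
  qed
  \<comment> \<open>The slack of \<open>h\<close> does not depend on \<open>k\<close>, since
    \<open>facet_vec h\<close> stays on the dilated hyperplane; the slack of every other
    \<open>g\<close> grows linearly in \<open>k\<close>.\<close>
  have "\<forall>\<^sub>F k in sequentially.
      a g \<bullet> (y + real k *\<^sub>R facet_vec h) \<le> (c + real k * facet_height h) * b g" if g: "g \<in> F" for g
  proof (cases "g = h")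
    case True
    then show ?thesis
      using y by (simp add: inner_add_right inner_facet_vec algebra_simps)
  next
    case False
    then have "0 < facet_height h * b g - a g \<bullet> facet_vec h"
      using g inner_facet_vec_less[OF h, of g] by auto
    from arch[OF this, of "a g \<bullet> y - c * b g"] show ?thesis
      by eventually_elim (simp add: inner_add_right algebra_simps)
  qed
  then have "\<forall>\<^sub>F k in sequentially. \<forall>g\<in>F.
      a g \<bullet> (y + real k *\<^sub>R facet_vec h) \<le> (c + real k * facet_height h) * b g"
    using finite_F by (simp add: eventually_ball_finite_distrib)
  moreover from arch[OF facet_height_pos[OF h], of "- c"]
  have "\<forall>\<^sub>F k in sequentially. 0 < c + real k * facet_height h"
    by eventually_elim simp
  ultimately show ?thesis
  proof eventually_elim
    case (elim k)
    moreover have "y + real k *\<^sub>R facet_vec h \<in> span V"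
      using y(1) facet_vec_span by (intro span_add span_scale)
    ultimately show ?case
      unfolding hull_eq by (auto intro!: span_scale simp: divide_le_eq mult.commute)
  qed
qed

lemma scaled_verts_integral: "finite ((\<lambda>v. real N *\<^sub>R v) ` V)" "(\<lambda>v. real N *\<^sub>R v) ` V \<subseteq> integer_lattice"
  using finite_V N_integral by auto

lemma span_scaled_verts: "finite A \<Longrightarrow> span ((\<lambda>v. real N *\<^sub>R v) ` A) = span A"
  using N_pos by (intro span_image_scale) auto

lemma integral_on_span_extends:
  assumes "\<And>v. v \<in> span V \<Longrightarrow> v \<in> integer_lattice \<Longrightarrow> f \<bullet> v \<in> \<int>"
  shows "\<exists>f'\<in>integer_lattice. \<forall>v\<in>span V. f' \<bullet> v = f \<bullet> v"
  using integral_functional_extends[OF scaled_verts_integral, of f] assms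
  by (simp add: span_scaled_verts finite_V)

text \<open>A lattice point \<open>w\<close> in the cone over the facet lies in the dilate by \<open>s = (a h \<bullet> w) / b h\<close>
  but in no smaller one, so the hypothesis forces \<open>s\<close> to be an integer. Every lattice point is a
  difference of two such points.\<close>

lemma facet_integral:
  assumes floor_le: "\<And>\<alpha> s w. (\<And>x. x \<in> convex hull V \<Longrightarrow> \<alpha> \<bullet> x \<le> 1) \<Longrightarrow> s > 0 \<Longrightarrow>
      w \<in> integer_lattice \<Longrightarrow> (1 / s) *\<^sub>R w \<in> convex hull V \<Longrightarrow> \<alpha> \<bullet> w \<le> of_int \<lfloor>s\<rfloor>"
    and h: "h \<in> F" and bh: "b h > 0"
  shows "\<exists>f\<in>integer_lattice. \<forall>x\<in>span V. f \<bullet> x = a h \<bullet> x / b h"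
proof -
  define \<alpha> where "\<alpha> = (1 / b h) *\<^sub>R a h"
  have \<alpha>: "\<alpha> \<bullet> x = a h \<bullet> x / b h" for x
    by (simp add: \<alpha>_def)
  have \<alpha>_le: "\<alpha> \<bullet> x \<le> 1" if "x \<in> convex hull V" for x
    using that h bh unfolding hull_eq \<alpha> by auto
  have \<alpha>_vec: "\<alpha> \<bullet> facet_vec h = facet_height h"
    using bh by (simp add: \<alpha> inner_facet_vec)
  define w where "w y k = y + real k *\<^sub>R facet_vec h" for y k
  have \<alpha>_w: "\<alpha> \<bullet> w y k = \<alpha> \<bullet> y + real k * facet_height h" for y k
    by (simp add: w_def inner_add_right \<alpha>_vec)
  have ev: "\<forall>\<^sub>F k in sequentially. \<alpha> \<bullet> w y k \<in> \<int>" if y: "y \<in> span V" "y \<in> integer_lattice" for y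
  proof -
    \<comment> \<open>With \<open>c = \<alpha> \<bullet> y\<close> the dilation factor is exactly
      the value of \<alpha> at \<open>w y k\<close>.\<close>
    have "a h \<bullet> y \<le> (\<alpha> \<bullet> y) * b h"
      using bh by (simp add: \<alpha>)
    from eventually_mem_dilate[OF h y(1) this] show ?thesis
    proof eventually_elim
      case (elim k)
      have "w y k \<in> integer_lattice"
        unfolding w_def using y(2) facet_vec_integral
        by (intro integer_lattice_add integer_lattice_scale) auto
      then have "\<alpha> \<bullet> w y k \<le> of_int \<lfloor>\<alpha> \<bullet> w y k\<rfloor>"
        using elim by (intro floor_le \<alpha>_le) (simp_all add: \<alpha>_w, simp_all add: w_def)
      then have "\<alpha> \<bullet> w y k = of_int \<lfloor>\<alpha> \<bullet> w y k\<rfloor>"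
        using of_int_floor_le[of "\<alpha> \<bullet> w y k"] by linarith
      then show ?case
        by (metis Ints_of_int)
    qed
  qed
  have "\<alpha> \<bullet> y \<in> \<int>" if y: "y \<in> span V" "y \<in> integer_lattice" for y
  proof -
    \<comment> \<open>Both values are integers for large \<open>k\<close>, and their difference
      \<open>\<alpha> \<bullet> y\<close> is independent of \<open>k\<close>.\<close>
    have "\<forall>\<^sub>F k in sequentially. \<alpha> \<bullet> w y k - \<alpha> \<bullet> w 0 k \<in> \<int>"
      using ev[OF y] ev[OF span_zero integer_lattice_0]
      by eventually_elim (rule Ints_diff)
    then show ?thesis
      by (simp add: \<alpha>_w)
  qed
  then show ?thesis
    using integral_on_span_extends[of \<alpha>] by (simp add: \<alpha>)
qed

text \<open>With right-hand side 0 any positive multiple describes the same halfspace, so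
  rationality suffices. The vertices on the facet, where \<open>a h\<close> vanishes, and one vertex
  off it generate \<open>span V\<close>; hence the values of \<open>a h\<close> on lattice points
  are the integer multiples of one number, up to scaling.\<close>

lemma facet_through_origin_integral:
  assumes h: "h \<in> F" and bh: "b h = 0"
  shows "\<exists>f\<in>integer_lattice. \<exists>c>0. \<forall>x\<in>span V. f \<bullet> x = c * (a h \<bullet> x)"
proof -
  define W where "W = (\<lambda>v. real N *\<^sub>R v) ` facet_verts h"
  have "\<exists>v\<in>V. a h \<bullet> v < 0"
  proof (rule ccontr)
    assume "\<not> ?thesis"
    then have "convex hull V \<subseteq> {x. a h \<bullet> x \<ge> 0}"
      by (intro hull_minimal convex_halfspace_ge) (auto simp: not_less)
    then show False
      using strict_point h bh by force
  qed
  then obtain v where v: "v \<in> V" "a h \<bullet> v < 0"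
    by blast
  define e where "e = real N *\<^sub>R v"
  have e: "e \<in> integer_lattice" "e \<in> span V" "0 < (- a h) \<bullet> e"
    using v N_pos N_integral by (auto simp: e_def span_scale span_base mult_pos_neg)
  have W: "finite W" "W \<subseteq> integer_lattice" "\<And>s. s \<in> W \<Longrightarrow> (- a h) \<bullet> s = 0"
    using N_integral bh finite_V by (auto simp: W_def facet_verts_def)
  \<comment> \<open>\<open>a h\<close> is negative at \<open>e\<close>, hence the change of
    sign.\<close>
  obtain w where w: "0 < (- a h) \<bullet> w"
    "\<And>x. x \<in> span (insert e W) \<Longrightarrow> x \<in> integer_lattice \<Longrightarrow> (- a h) \<bullet> x / ((- a h) \<bullet> w) \<in> \<int>"
    using integer_functional_discrete[OF W(1,2) e(1) W(3) e(3)] by blast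
  have span: "x \<in> span (insert e W)" if x: "x \<in> span V" for x
  proof -
    define y where "y = x - ((a h \<bullet> x) / (a h \<bullet> e)) *\<^sub>R e"
    have y: "y \<in> span V" "a h \<bullet> y = 0"
      using x e by (auto simp: y_def inner_diff_right intro!: span_diff span_scale)
    \<comment> \<open>Since \<open>a h \<bullet> y = 0 = b h\<close>, the shift \<open>c = 0\<close>
      is admissible. The scaled point \<open>q\<close> lies on the facet, which puts
      \<open>y\<close> into the span of the facet's vertices.\<close>
    then have "\<forall>\<^sub>F k in sequentially. 0 < 0 + real k * facet_height h \<and>
        (1 / (0 + real k * facet_height h)) *\<^sub>R (y + real k *\<^sub>R facet_vec h) \<in> convex hull V"
      by (intro eventually_mem_dilate h) (auto simp: bh)
    then obtain k where "0 < real k * facet_height h"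
      "(1 / (real k * facet_height h)) *\<^sub>R (y + real k *\<^sub>R facet_vec h) \<in> convex hull V"
      by (auto simp: eventually_sequentially)
    moreover define r q where "r = real k * facet_height h"
      and "q = (1 / r) *\<^sub>R (y + real k *\<^sub>R facet_vec h)"
    ultimately have r: "r > 0" and q: "q \<in> convex hull V"
      by simp_all
    have "a h \<bullet> q = b h"
      using y(2) by (simp add: q_def inner_add_right inner_facet_vec bh)
    then have "q \<in> span (facet_verts h)"
      using mem_hull_facet_verts[OF h q] convex_hull_subset_span by blast
    moreover have "facet_vec h \<in> span (facet_verts h)"
      unfolding facet_vec_def by (intro span_scale span_sum span_base)
    ultimately have "r *\<^sub>R q - real k *\<^sub>R facet_vec h \<in> span (facet_verts h)"
      by (intro span_diff span_scale)
    moreover have "r *\<^sub>R q - real k *\<^sub>R facet_vec h = y"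
      using r by (simp add: q_def)
    ultimately have "y \<in> span W"
      by (simp add: W_def span_scaled_verts)
    then show ?thesis
      unfolding y_def span_insert by blast
  qed
  define c where "c = 1 / ((- a h) \<bullet> w)"
  have c: "c > 0"
    using w(1) by (simp add: c_def)
  have "(c *\<^sub>R a h) \<bullet> x \<in> \<int>" if "x \<in> span V" "x \<in> integer_lattice" for x
    using Ints_minus[OF w(2)[OF span[OF that(1)] that(2)]] by (simp add: c_def)
  then show ?thesis
    using integral_on_span_extends[of "c *\<^sub>R a h"] c by auto
qed

text \<open>The integral functionals replace the facet functionals on \<open>span V\<close> only, so
  integral inequalities with offset 0 that cut out \<open>span V\<close> are added.\<close>

lemma integral_halfspaces:
  assumes floor_le: "\<And>\<alpha> s w. (\<And>x. x \<in> convex hull V \<Longrightarrow> \<alpha> \<bullet> x \<le> 1) \<Longrightarrow> s > 0 \<Longrightarrow>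
      w \<in> integer_lattice \<Longrightarrow> (1 / s) *\<^sub>R w \<in> convex hull V \<Longrightarrow> \<alpha> \<bullet> w \<le> of_int \<lfloor>s\<rfloor>"
  shows "\<exists>G. finite G \<and> G \<subseteq> integer_lattice \<times> {0, 1} \<and>
    convex hull V = (\<Inter>(f, \<beta>)\<in>G. {x. f \<bullet> x \<le> \<beta>})"
proof -
  obtain C where C: "finite C" "C \<subseteq> integer_lattice" "span V = {x. \<forall>c\<in>C. c \<bullet> x \<le> 0}"
    using integer_span_eq_halfspaces[OF scaled_verts_integral] by (auto simp: span_scaled_verts finite_V)
  have "\<exists>p \<in> integer_lattice \<times> {0, 1}. \<forall>x\<in>span V. a h \<bullet> x \<le> b h \<longleftrightarrow> fst p \<bullet> x \<le> snd p"
    if h: "h \<in> F" for h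
  proof (cases "b h = 0")
    case True
    obtain f c where "f \<in> integer_lattice" "c > 0" "\<forall>x\<in>span V. f \<bullet> x = c * (a h \<bullet> x)"
      using facet_through_origin_integral[OF h True] by blast
    then show ?thesis
      using True by (intro bexI[of _ "(f, 0)"]) (auto simp: mult_le_0_iff)
  next
    case False
    then have bh: "b h > 0"
      using b_nonneg[OF h] by simp
    obtain f where "f \<in> integer_lattice" "\<forall>x\<in>span V. f \<bullet> x = a h \<bullet> x / b h"
      using facet_integral[OF floor_le h bh] by blast
    then show ?thesis
      using bh by (intro bexI[of _ "(f, 1)"]) auto
  qed
  then obtain p where p: "\<And>h. h \<in> F \<Longrightarrow> p h \<in> integer_lattice \<times> {0, 1}"
    "\<And>h x. h \<in> F \<Longrightarrow> x \<in> span V \<Longrightarrow> a h \<bullet> x \<le> b h \<longleftrightarrow> fst (p h) \<bullet> x \<le> snd (p h)"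
    by metis
  have "convex hull V = (\<Inter>(f, \<beta>)\<in>C \<times> {0} \<union> p ` F. {x. f \<bullet> x \<le> \<beta>})"
  proof -
    have "x \<in> convex hull V \<longleftrightarrow> x \<in> span V \<and> (\<forall>h\<in>F. fst (p h) \<bullet> x \<le> snd (p h))" for x
      unfolding hull_eq using p(2) by auto
    moreover have "x \<in> (\<Inter>(f, \<beta>)\<in>C \<times> {0} \<union> p ` F. {x. f \<bullet> x \<le> \<beta>}) \<longleftrightarrow>
        x \<in> span V \<and> (\<forall>h\<in>F. fst (p h) \<bullet> x \<le> snd (p h))" for x
      unfolding C(3) by (simp add: case_prod_unfold ball_Un)
    ultimately show ?thesis
      by blast
  qed
  then show ?thesis
    using C(1,2) p(1) finite_F by (intro exI[of _ "C \<times> {0} \<union> p ` F"]) blast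
qed

end

section \<open>Halfspace description of a semi-reflexive polytope\<close>

lemma semi_reflexive_imp_halfspaces:
  fixes P :: "(real ^ 'd) set"
  assumes P: "semi_reflexive P"
  shows "\<exists>G. finite G \<and> G \<subseteq> integer_lattice \<times> {0, 1} \<and> P = (\<Inter>(f, \<beta>)\<in>G. {x. f \<bullet> x \<le> \<beta>})"
proof -
  have poly: "polytope P" and rat: "\<And>v j. v extreme_point_of P \<Longrightarrow> v $ j \<in> \<rat>"
    using P by (auto simp: semi_reflexive_def rational_polytope_def)
  define V where "V = {v. v extreme_point_of P}"
  have V: "finite V" "P = convex hull V"
    using poly finite_polyhedron_extreme_points[OF polytope_imp_polyhedron]
      Krein_Milman_Minkowski[of P]
    by (auto simp: V_def polytope_imp_compact polytope_imp_convex)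
  have P0: "0 \<in> P"
    by (rule semi_reflexive_zero_mem[OF P])
  have aff: "affine hull P = span V"
    using P0 V affine_hull_span_0[of V] convex_hull_subset_affine_hull[of V]
    by (auto simp: affine_hull_convex_hull)
  obtain N where N: "N > 0" "\<And>v. v \<in> V \<Longrightarrow> real N *\<^sub>R v \<in> integer_lattice"
    using rational_common_denominator[OF V(1)] rat by (auto simp: V_def)
  obtain F where F: "finite F" "P = affine hull P \<inter> \<Inter>F"
      "\<And>h. h \<in> F \<Longrightarrow> \<exists>a b. a \<noteq> 0 \<and> h = {x. a \<bullet> x \<le> b}"
      "\<And>F'. F' \<subset> F \<Longrightarrow> P \<subset> affine hull P \<inter> \<Inter>F'"
    using polytope_imp_polyhedron[OF poly] polyhedron_Int_affine_minimal[of P] by auto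
  obtain a b where ab: "\<And>h. h \<in> F \<Longrightarrow> a h \<noteq> 0 \<and> h = {x. a h \<bullet> x \<le> b h}"
    using F(3) by metis
  have mem_iff: "x \<in> P \<longleftrightarrow> x \<in> span V \<and> (\<forall>h\<in>F. a h \<bullet> x \<le> b h)" for x
    using F(2) ab unfolding aff by blast
  interpret irredundant_polytope V F a b N
  proof
    show "convex hull V = {x \<in> span V. \<forall>h\<in>F. a h \<bullet> x \<le> b h}"
      using mem_iff V(2) by auto
    \<comment> \<open>Any point of the relative interior will do; it exists because \<open>P\<close>
      contains 0.\<close>
    show "\<exists>x\<in>convex hull V. \<forall>h\<in>F. a h \<bullet> x < b h"
      using rel_interior_polyhedron_explicit[OF F(1,2) ab F(4)] P0
        rel_interior_eq_empty[OF semi_reflexive_convex[OF P]] V(2) by auto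
    show "\<exists>y\<in>span V. b h < a h \<bullet> y \<and> (\<forall>g\<in>F - {h}. a g \<bullet> y \<le> b g)" if h: "h \<in> F" for h
    proof -
      \<comment> \<open>By minimality, dropping \<open>h\<close> admits a point outside
        \<open>P\<close>, and the only inequality it can violate is that of
        \<open>h\<close>.\<close>
      have "P \<subset> affine hull P \<inter> \<Inter>(F - {h})"
        using h by (intro F(4)) blast
      then obtain y where y: "y \<in> span V" "y \<in> \<Inter>(F - {h})" "y \<notin> P"
        unfolding aff by blast
      then have le: "\<forall>g\<in>F - {h}. a g \<bullet> y \<le> b g"
        using ab by blast
      moreover have "b h < a h \<bullet> y"
        using y(1,3) le mem_iff by (metis DiffI not_le singletonD)
      ultimately show ?thesis
        using y(1) by blast
    qed
  qed (use V F(1) N P0 in auto)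
  show ?thesis
    unfolding V(2)
    by (intro integral_halfspaces semi_reflexive_functional_le_floor[OF P]) (simp_all add: V(2))
qed

theorem theorem1:
  fixes P :: "(real ^ 'd) set"
  assumes "rational_polytope P"
  shows "semi_reflexive P \<longleftrightarrow>
    (\<exists>(n::nat) (a :: nat \<Rightarrow> real ^ 'd) (b :: nat \<Rightarrow> real).
      (\<forall>i\<in>{1..n}. a i \<in> integer_lattice \<and> b i \<in> {0, 1}) \<and>
      P = (\<Inter>i\<in>{1..n}. {x. a i \<bullet> x \<le> b i}))"
proof
  assume "semi_reflexive P"
  then obtain G where G: "finite G" "G \<subseteq> integer_lattice \<times> {0, 1}"
      "P = (\<Inter>(f, \<beta>)\<in>G. {x. f \<bullet> x \<le> \<beta>})"
    using semi_reflexive_imp_halfspaces by blast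
  obtain p where "bij_betw p {1..card G} G"
    using ex_bij_betw_nat_finite_1[OF G(1)] by blast
  then have p: "G = p ` {1..card G}"
    by (simp add: bij_betw_def)
  have "\<forall>i\<in>{1..card G}. fst (p i) \<in> integer_lattice \<and> snd (p i) \<in> {0, 1}"
    using G(2) p by (metis image_subset_iff mem_Times_iff)
  moreover have "P = (\<Inter>i\<in>{1..card G}. {x. fst (p i) \<bullet> x \<le> snd (p i)})"
    unfolding G(3) by (subst p) (auto simp: case_prod_unfold)
  ultimately show "\<exists>(n::nat) (a :: nat \<Rightarrow> real ^ 'd) (b :: nat \<Rightarrow> real). (\<forall>i\<in>{1..n}. a i \<in> integer_lattice \<and> b i \<in> {0, 1}) \<and>
      P = (\<Inter>i\<in>{1..n}. {x. a i \<bullet> x \<le> b i})"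
    by (intro exI[of _ "card G"] exI[of _ "\<lambda>i. fst (p i)"] exI[of _ "\<lambda>i. snd (p i)"]) blast
next
  assume "\<exists>(n::nat) (a :: nat \<Rightarrow> real ^ 'd) (b :: nat \<Rightarrow> real). (\<forall>i\<in>{1..n}. a i \<in> integer_lattice \<and> b i \<in> {0, 1}) \<and>
      P = (\<Inter>i\<in>{1..n}. {x. a i \<bullet> x \<le> b i})"
  then obtain n :: nat and a :: "nat \<Rightarrow> real ^ 'd" and b :: "nat \<Rightarrow> real"
    where "\<forall>i\<in>{1..n}. a i \<in> integer_lattice \<and> b i \<in> {0, 1}"
      "P = (\<Inter>i\<in>{1..n}. {x. a i \<bullet> x \<le> b i})"
    by blast
  then show "semi_reflexive P"
    using assms by (intro semi_reflexive_if_halfspaces[of P "{1..n}" a b]) auto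
qed

end
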